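(* Let $X$ be a complete metric space, let $K:X\times X\to\mathbb{R}$ be a continuous admissible kernel with native space $H$, and suppose there is a constant $\bar K>0$ with $\sqrt{K(x,x)}\le\bar K$ for all $x\in X$. Let $\phi:[0,\infty)\to X$ be continuous, let $\nu$ be Lebesgue measure on $[0,\infty)$, let $G\in H$, and let $\gamma>0$. Let $S\subseteq X$, let $H_S:=\overline{\operatorname{span}\{K_x : x\in S\}}\subseteq H$ with the norm inherited from $H$, and let $\Pi_S$ be the $H$-orthogonal projection of $H$ onto $H_S$. Suppose that the persistency of excitation condition holds over $H_S$: there are constants $\gamma_1,\gamma_2,\Delta>0$ such that $$\gamma_1\|g\|_H^2\le\langle T_\phi(t,t+\Delta)g,g\rangle_H\le\gamma_2\|g\|_H^2\qquad\text{for all } t\ge 0 \text{ and } g\in H_S.$$ Let $t=m\Delta$ for a positive integer $m$, and let $\hat g_S(t,\cdot)\in H_S$ be the optimal regressor in $H_S$, i.e. the solution of $$\langle (T_\phi(0,t)+\gamma I)\hat g_S(t,\cdot),h\rangle_H=\langle T_\phi(0,t)G,h\rangle_H\qquad\text{for all } h\in H_S.$$ Then $$\|\hat g_S(t,\cdot)-\Pi_SG\|_H\le\frac{\bar K^2m\Delta}{\gamma_1m+\gamma}\,\|(I-\Pi_S)G\|_H+\frac{\gamma}{\gamma_1m+\gamma}\,\|\Pi_SG\|_H.$$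
   Context: An admissible kernel is a symmetric, nonnegative (i.e. positive semidefinite) function $K:X\times X\to\mathbb{R}$. For $x\in X$ write $K_x:=K(x,\cdot)$. The native space $H=\overline{\operatorname{span}\{K_x : x\in X\}}$ is the reproducing kernel Hilbert space of real-valued functions on $X$ with reproducing kernel $K$. For $0\le a\le b$, the operator $T_\phi(a,b):H\to H$ is $$T_\phi(a,b)g:=\int_a^b \langle K_{\phi(\tau)},g\rangle_H\,K_{\phi(\tau)}\,\nu(d\tau)=\int_a^b g(\phi(\tau))\,K_{\phi(\tau)}\,\nu(d\tau)$$ (Bochner integral). The regressor $\hat g_S(t,\cdot)$ corresponds to minimizing, over $g\in H_S$, the functional $\tfrac12\int_0^t|y(\tau)-g(\phi(\tau))|^2\,\nu(d\tau)+\tfrac12\gamma\|g\|_H^2$, where $y(\tau)=G(\phi(\tau))$ are observations of the unknown function $G$ along the trajectory. *)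

theory Defs
  imports "HOL-Analysis.Analysis"
begin

definition admissible_kernel :: "('x \<Rightarrow> 'x \<Rightarrow> real) \<Rightarrow> bool" where
  "admissible_kernel K \<longleftrightarrow>
     (\<forall>x y. K x y = K y x) \<and>
     (\<forall>A c. finite A \<longrightarrow> (\<Sum>x\<in>A. \<Sum>y\<in>A. c x * c y * K x y) \<ge> 0)"

text \<open>
  A space of real-valued functions on \<^typ>\<open>'x\<close> is given as a Hilbert space \<^typ>\<open>'h\<close> together with
  an injective linear map \<open>ev\<close> sending each element \<open>g\<close> to the function \<open>ev g\<close> that it
  stands for; \<open>ksec K ev x\<close> is the element standing for \<open>K x\<close>, i.e. for \<open>K(x, _)\<close>.
\<close>

definition ksec :: "('x \<Rightarrow> 'x \<Rightarrow> real) \<Rightarrow> ('h \<Rightarrow> 'x \<Rightarrow> real) \<Rightarrow> 'x \<Rightarrow> 'h" where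
  "ksec K ev x = (THE k. ev k = K x)"

text \<open>
  The completion of the span of the \<open>K x\<close> is only determined together with its inner product,
  which is the one having the reproducing property.
\<close>

definition native_space ::
    "('x \<Rightarrow> 'x \<Rightarrow> real) \<Rightarrow> ('h::{real_inner, banach} \<Rightarrow> 'x \<Rightarrow> real) \<Rightarrow> bool" where
  "native_space K ev \<longleftrightarrow>
     (\<forall>x. linear (\<lambda>g. ev g x)) \<and> inj ev \<and>
     (\<forall>x. K x \<in> range ev) \<and>
     (\<forall>x g. inner (ksec K ev x) g = ev g x) \<and>
     closure (span (range (ksec K ev))) = UNIV"

definition native_subspace ::
    "('x \<Rightarrow> 'x \<Rightarrow> real) \<Rightarrow> ('h::{real_inner, banach} \<Rightarrow> 'x \<Rightarrow> real) \<Rightarrow> 'x set \<Rightarrow> 'h set" where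
  "native_subspace K ev S = closure (span (ksec K ev ` S))"

text \<open>
  The library's \<^const>\<open>has_bochner_integral\<close> and \<^const>\<open>lebesgue_integral\<close> require a
  second countable codomain, but a native space over a non-separable metric space need not be
  separable. The following is the library's definition without that restriction. Approximability
  by simple functions already makes the integrand almost everywhere separably valued.
\<close>

definition has_banach_bochner_integral ::
    "'a measure \<Rightarrow> ('a \<Rightarrow> 'b::banach) \<Rightarrow> 'b \<Rightarrow> bool" where
  "has_banach_bochner_integral M f v \<longleftrightarrow>
     f \<in> borel_measurable M \<and>
     (\<exists>s. (\<forall>i. Bochner_Integration.simple_bochner_integrable M (s i)) \<and>
          (\<lambda>i. \<integral>\<^sup>+x. ennreal (norm (f x - s i x)) \<partial>M) \<longlonglongrightarrow> 0 \<and>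
          (\<lambda>i. Bochner_Integration.simple_bochner_integral M (s i)) \<longlonglongrightarrow> v)"

definition banach_bochner_integral :: "'a measure \<Rightarrow> ('a \<Rightarrow> 'b::banach) \<Rightarrow> 'b" where
  "banach_bochner_integral M f = (THE v. has_banach_bochner_integral M f v)"

definition excitation_op ::
    "('x \<Rightarrow> 'x \<Rightarrow> real) \<Rightarrow> ('h::{real_inner, banach} \<Rightarrow> 'x \<Rightarrow> real) \<Rightarrow> (real \<Rightarrow> 'x)
       \<Rightarrow> real \<Rightarrow> real \<Rightarrow> 'h \<Rightarrow> 'h" where
  "excitation_op K ev \<phi> a b g =
     banach_bochner_integral (lebesgue_on {a..b})
       (\<lambda>\<tau>. inner (ksec K ev (\<phi> \<tau>)) g *\<^sub>R ksec K ev (\<phi> \<tau>))"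

definition persistently_exciting ::
    "('x \<Rightarrow> 'x \<Rightarrow> real) \<Rightarrow> ('h::{real_inner, banach} \<Rightarrow> 'x \<Rightarrow> real) \<Rightarrow> (real \<Rightarrow> 'x)
       \<Rightarrow> 'h set \<Rightarrow> real \<Rightarrow> real \<Rightarrow> real \<Rightarrow> bool" where
  "persistently_exciting K ev \<phi> M \<gamma>1 \<gamma>2 \<Delta> \<longleftrightarrow>
     \<gamma>1 > 0 \<and> \<gamma>2 > 0 \<and> \<Delta> > 0 \<and>
     (\<forall>t\<ge>0. \<forall>g\<in>M.
        \<gamma>1 * (norm g)\<^sup>2 \<le> inner (excitation_op K ev \<phi> t (t + \<Delta>) g) g \<and>
        inner (excitation_op K ev \<phi> t (t + \<Delta>) g) g \<le> \<gamma>2 * (norm g)\<^sup>2)"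

text \<open>
  Meant for closed subspaces \<open>M\<close>, where the projection exists and is unique. The library's
  \<^const>\<open>closest_point\<close> is limited to finite-dimensional spaces.
\<close>

definition orth_proj :: "'h::real_inner set \<Rightarrow> 'h \<Rightarrow> 'h" where
  "orth_proj M g = (THE p. p \<in> M \<and> (\<forall>h\<in>M. inner (g - p) h = 0))"

text \<open>Weak form of the normal equations for the regularized least squares problem over \<open>M\<close>.\<close>

definition optimal_regressor ::
    "('x \<Rightarrow> 'x \<Rightarrow> real) \<Rightarrow> ('h::{real_inner, banach} \<Rightarrow> 'x \<Rightarrow> real) \<Rightarrow> (real \<Rightarrow> 'x)
       \<Rightarrow> 'h set \<Rightarrow> real \<Rightarrow> 'h \<Rightarrow> real \<Rightarrow> 'h \<Rightarrow> bool" where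
  "optimal_regressor K ev \<phi> M \<gamma> G t u \<longleftrightarrow>
     u \<in> M \<and>
     (\<forall>h\<in>M. inner (excitation_op K ev \<phi> 0 t u + \<gamma> *\<^sub>R u) h
              = inner (excitation_op K ev \<phi> 0 t G) h)"

end

theory Submission
  imports Defs
begin

text \<open>
  With \<open>P\<close> the projection of \<open>G\<close> and \<open>e = ghat - P\<close>, testing the normal equations with \<open>e\<close> itself
  gives \<open>\<langle>(T + \<gamma>) e, e\<rangle> = \<langle>T (G - P), e\<rangle> - \<gamma> \<langle>P, e\<rangle>\<close>. Adding up the persistency of excitation
  condition over the \<open>m\<close> windows of length \<open>\<Delta>\<close> bounds the left side below by
  \<open>(\<gamma>1 m + \<gamma>) \<parallel>e\<parallel>\<^sup>2\<close>; Cauchy-Schwarz bounds the right side above. Only the form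
  \<open>\<langle>T g, h\<rangle>\<close> matters; since the integrand of \<open>T\<close> is continuous, its Bochner integral is a
  Henstock-Kurzweil integral.
\<close>

subsection \<open>Bochner integrals without second countability\<close>

text \<open>In a nonseparable space, a difference of Borel functions need not be measurable. Here
  \<open>s\<close> has finitely many values, and where \<open>s\<close> equals a fixed
  \<open>y\<close> the expression is a continuous function of \<open>f\<close> alone.\<close>

lemma borel_measurable_norm_diff_simple_function:
  fixes f s :: "'a \<Rightarrow> 'b::real_normed_vector"
  assumes f: "f \<in> borel_measurable M" and s: "simple_function M s"
  shows "(\<lambda>x. norm (f x - s x)) \<in> borel_measurable M"
proof (rule measurable_compose_countable'[where f = "\<lambda>y x. norm (f x - y)" and I = "s ` space M"])
  show "(\<lambda>x. norm (f x - y)) \<in> borel_measurable M" for y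
    by (rule measurable_compose[OF f])
       (intro borel_measurable_continuous_onI continuous_intros)
  show "s \<in> measurable M (count_space (s ` space M))"
    using s by (rule simple_functionD(1)[THEN measurable_count_space_eq2, THEN iffD2])
       (auto simp: simple_functionD(2)[OF s])
  show "countable (s ` space M)"
    using simple_functionD(1)[OF s] by (rule countable_finite)
qed

text \<open>Pairing with \<open>h\<close> is bounded linear, so it turns approximating simple
  functions into approximating simple functions and enlarges the L1 error by at most the factor
  \<open>norm h\<close>. This reduces vector integrals to real ones.\<close>

lemma has_bochner_integral_inner_of_banach:
  fixes f :: "'a \<Rightarrow> 'b::{real_inner, banach}"
  assumes "has_banach_bochner_integral M f v"
  shows "has_bochner_integral M (\<lambda>x. f x \<bullet> h) (v \<bullet> h)"
proof -
  from assms obtain s where f: "f \<in> borel_measurable M"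
    and s: "\<And>i. Bochner_Integration.simple_bochner_integrable M (s i)"
    and lim: "(\<lambda>i. \<integral>\<^sup>+x. ennreal (norm (f x - s i x)) \<partial>M) \<longlonglongrightarrow> 0"
    and v: "(\<lambda>i. Bochner_Integration.simple_bochner_integral M (s i)) \<longlonglongrightarrow> v"
    unfolding has_banach_bochner_integral_def by blast
  have sf: "simple_function M (s i)" for i
    using s by (auto elim: simple_bochner_integrable.cases)
  show ?thesis
  proof (rule has_bochner_integral.intros)
    show "(\<lambda>x. f x \<bullet> h) \<in> borel_measurable M"
      by (rule measurable_compose[OF f])
         (intro borel_measurable_continuous_onI continuous_intros)
    show "Bochner_Integration.simple_bochner_integrable M (\<lambda>x. s i x \<bullet> h)" for i
      \<comment> \<open>The composition rule is binary; its second slot is filled with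
        \<open>s i\<close> again and ignored.\<close>
      using simple_bochner_integrable_compose2[OF _ s s, of "\<lambda>y _. y \<bullet> h"] by simp
    show "(\<lambda>i. \<integral>\<^sup>+x. ennreal (norm (f x \<bullet> h - s i x \<bullet> h)) \<partial>M) \<longlonglongrightarrow> 0"
    proof (rule tendsto_sandwich[OF _ _ tendsto_const])
      show "\<forall>\<^sub>F i in sequentially. 0 \<le> (\<integral>\<^sup>+x. ennreal (norm (f x \<bullet> h - s i x \<bullet> h)) \<partial>M)"
        by simp
      show "\<forall>\<^sub>F i in sequentially. (\<integral>\<^sup>+x. ennreal (norm (f x \<bullet> h - s i x \<bullet> h)) \<partial>M)
          \<le> ennreal (norm h) * (\<integral>\<^sup>+x. ennreal (norm (f x - s i x)) \<partial>M)"
      proof (intro always_eventually allI)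
        fix i
        have "(\<integral>\<^sup>+x. ennreal (norm (f x \<bullet> h - s i x \<bullet> h)) \<partial>M)
            \<le> (\<integral>\<^sup>+x. ennreal (norm h) * ennreal (norm (f x - s i x)) \<partial>M)"
        proof (rule nn_integral_mono)
          fix x
          have "norm (f x \<bullet> h - s i x \<bullet> h) \<le> norm h * norm (f x - s i x)"
            using Cauchy_Schwarz_ineq2[of "f x - s i x" h]
            by (simp add: inner_diff_left mult.commute)
          then show "ennreal (norm (f x \<bullet> h - s i x \<bullet> h))
              \<le> ennreal (norm h) * ennreal (norm (f x - s i x))"
            by (simp flip: ennreal_mult)
        qed
        also have "\<dots> = ennreal (norm h) * (\<integral>\<^sup>+x. ennreal (norm (f x - s i x)) \<partial>M)"
          using borel_measurable_norm_diff_simple_function[OF f sf] by (intro nn_integral_cmult) simp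
        finally show "(\<integral>\<^sup>+x. ennreal (norm (f x \<bullet> h - s i x \<bullet> h)) \<partial>M)
            \<le> ennreal (norm h) * (\<integral>\<^sup>+x. ennreal (norm (f x - s i x)) \<partial>M)" .
      qed
      show "(\<lambda>i. ennreal (norm h) * (\<integral>\<^sup>+x. ennreal (norm (f x - s i x)) \<partial>M)) \<longlonglongrightarrow> 0"
        using ennreal_tendsto_cmult[OF _ lim, of "ennreal (norm h)"] by simp
    qed
    have "linear (\<lambda>y. y \<bullet> h)"
      by (rule bounded_linear.linear[OF bounded_linear_inner_left])
    then show "(\<lambda>i. Bochner_Integration.simple_bochner_integral M (\<lambda>x. s i x \<bullet> h)) \<longlonglongrightarrow> v \<bullet> h"
      using tendsto_inner[OF v tendsto_const, of h]
      by (simp add: simple_bochner_integral_linear[OF \<open>linear (\<lambda>y. y \<bullet> h)\<close> s])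
  qed
qed

text \<open>Real integrals are unique, and the pairings with all \<open>h\<close> separate points.
  This justifies the \<open>THE\<close> in \<open>banach_bochner_integral\<close>.\<close>

lemma has_banach_bochner_integral_unique:
  fixes f :: "'a \<Rightarrow> 'b::{real_inner, banach}"
  assumes "has_banach_bochner_integral M f v" "has_banach_bochner_integral M f w"
  shows "v = w"
proof -
  have "v \<bullet> h = w \<bullet> h" for h
    using assms[THEN has_bochner_integral_inner_of_banach, of h] by (rule has_bochner_integral_eq)
  then show ?thesis
    by (metis vector_eq_rdot)
qed

lemma banach_bochner_integral_eqI:
  fixes f :: "'a \<Rightarrow> 'b::{real_inner, banach}"
  assumes "has_banach_bochner_integral M f v"
  shows "banach_bochner_integral M f = v"
  unfolding banach_bochner_integral_def
  using assms by (rule the_equality) (rule has_banach_bochner_integral_unique[OF _ assms])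

text \<open>Round down to a grid of mesh \<open>1 / c = \<delta> / 2\<close>. Clipping at
  \<open>a\<close> keeps the rounded point inside the interval, so a function that is continuous
  only there can be composed with \<open>p\<close>.\<close>

lemma real_interval_simple_approximation:
  fixes a b \<delta> :: real
  assumes "\<delta> > 0"
  obtains p where "simple_function (lebesgue_on {a..b}) p"
    "\<And>x. x \<in> {a..b} \<Longrightarrow> p x \<in> {a..b} \<and> dist (p x) x < \<delta>"
proof
  define c where "c = 2 / \<delta>"
  have c: "c > 0" "1 / c < \<delta>"
    using assms by (auto simp: c_def)
  define p where "p x = max a (of_int \<lfloor>c * x\<rfloor> / c)" for x
  show "simple_function (lebesgue_on {a..b}) p"
  proof (rule simple_function_borel_measurable)
    have "p \<in> borel_measurable borel"
      unfolding p_def by measurable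
    then show "p \<in> borel_measurable (lebesgue_on {a..b})"
      by (intro measurable_restrict_space1 measurable_completion) simp
    have "p ` space (lebesgue_on {a..b})
        \<subseteq> (\<lambda>k. max a (of_int k / c)) ` {\<lfloor>c * a\<rfloor>..\<lfloor>c * b\<rfloor>}"
      unfolding p_def
    proof (rule image_subsetI)
      fix x assume "x \<in> space (lebesgue_on {a..b})"
      then have "\<lfloor>c * x\<rfloor> \<in> {\<lfloor>c * a\<rfloor>..\<lfloor>c * b\<rfloor>}"
        using c by (auto intro!: floor_mono mult_left_mono)
      then show "max a (of_int \<lfloor>c * x\<rfloor> / c)
          \<in> (\<lambda>k. max a (of_int k / c)) ` {\<lfloor>c * a\<rfloor>..\<lfloor>c * b\<rfloor>}"
        by (rule imageI)
    qed
    then show "finite (p ` space (lebesgue_on {a..b}))"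
      by (rule finite_subset) auto
  qed
  fix x assume x: "x \<in> {a..b}"
  have "of_int \<lfloor>c * x\<rfloor> / c \<le> x" "x < of_int \<lfloor>c * x\<rfloor> / c + 1 / c"
    using c floor_correct[of "c * x"] by (simp_all add: field_simps)
  then show "p x \<in> {a..b} \<and> dist (p x) x < \<delta>"
    using x c by (auto simp: p_def dist_real_def max_def)
qed

text \<open>Composing \<open>f\<close> with ever finer roundings gives simple functions that
  converge uniformly, by uniform continuity on a compact interval. The measure is finite, so they
  also converge in L1.\<close>

lemma has_banach_bochner_integral_continuous:
  fixes f :: "real \<Rightarrow> 'b::{real_inner, banach}"
  assumes cont: "continuous_on {a..b} f"
  shows "has_banach_bochner_integral (lebesgue_on {a..b}) f (integral {a..b} f)"
proof -
  let ?M = "lebesgue_on {a..b}"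
  \<comment> \<open>The maximum with 0 covers \<open>b < a\<close>, where the interval is
    empty.\<close>
  have emeas: "emeasure ?M (space ?M) = ennreal (max 0 (b - a))"
    by (simp add: emeasure_restrict_space emeasure_lborel_Icc_eq max_def)
  have meas: "f \<in> borel_measurable ?M"
    using cont by (rule continuous_imp_measurable_on_sets_lebesgue) simp
  have "\<exists>s. simple_function ?M s \<and> (\<forall>x\<in>{a..b}. norm (f x - s x) \<le> 1 / real (Suc n))" for n
  proof -
    have "uniformly_continuous_on {a..b} f"
      using cont by (rule compact_uniformly_continuous) simp
    moreover have "0 < 1 / real (Suc n)"
      by simp
    ultimately obtain \<delta> where \<delta>: "\<delta> > 0"
      "\<And>x y. x \<in> {a..b} \<Longrightarrow> y \<in> {a..b} \<Longrightarrow> dist y x < \<delta> \<Longrightarrow> dist (f y) (f x) < 1 / real (Suc n)"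
      unfolding uniformly_continuous_on_def by blast
    obtain p where p: "simple_function ?M p"
      "\<And>x. x \<in> {a..b} \<Longrightarrow> p x \<in> {a..b} \<and> dist (p x) x < \<delta>"
      using real_interval_simple_approximation[OF \<delta>(1)] by blast
    show ?thesis
    proof (intro exI[of _ "\<lambda>x. f (p x)"] conjI ballI)
      show "simple_function ?M (\<lambda>x. f (p x))"
        using p(1) by (rule simple_function_compose1)
      fix x assume x: "x \<in> {a..b}"
      then have "dist (f (p x)) (f x) < 1 / real (Suc n)"
        using p(2) by (intro \<delta>(2)) auto
      then show "norm (f x - f (p x)) \<le> 1 / real (Suc n)"
        unfolding dist_norm by (subst norm_minus_commute) (rule less_imp_le)
    qed
  qed
  then obtain s where sf: "\<And>n. simple_function ?M (s n)"
    and close: "\<And>n x. x \<in> {a..b} \<Longrightarrow> norm (f x - s n x) \<le> 1 / real (Suc n)"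
    by metis
  have sb: "Bochner_Integration.simple_bochner_integrable ?M (s n)" for n
  proof (rule simple_bochner_integrable.intros[OF sf])
    have "emeasure ?M {y \<in> space ?M. s n y \<noteq> 0} \<le> emeasure ?M (space ?M)"
      by (rule emeasure_space)
    then show "emeasure ?M {y \<in> space ?M. s n y \<noteq> 0} \<noteq> \<infinity>"
      unfolding emeas by (auto simp: top_unique)
  qed
  have null: "(\<lambda>n. max 0 (b - a) * (1 / real (Suc n))) \<longlonglongrightarrow> 0"
    using tendsto_mult_right_zero[OF LIMSEQ_inverse_real_of_nat] by (simp add: inverse_eq_divide)
  have lim: "(\<lambda>n. \<integral>\<^sup>+x. ennreal (norm (f x - s n x)) \<partial>?M) \<longlonglongrightarrow> 0"
  proof (rule tendsto_sandwich[OF _ _ tendsto_const])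
    show "\<forall>\<^sub>F n in sequentially. 0 \<le> (\<integral>\<^sup>+x. ennreal (norm (f x - s n x)) \<partial>?M)"
      by simp
    show "\<forall>\<^sub>F n in sequentially. (\<integral>\<^sup>+x. ennreal (norm (f x - s n x)) \<partial>?M)
        \<le> ennreal (max 0 (b - a) * (1 / real (Suc n)))"
    proof (intro always_eventually allI)
      fix n
      have "(\<integral>\<^sup>+x. ennreal (norm (f x - s n x)) \<partial>?M) \<le> (\<integral>\<^sup>+x. ennreal (1 / real (Suc n)) \<partial>?M)"
        using close by (intro nn_integral_mono ennreal_leI) auto
      also have "\<dots> = ennreal (1 / real (Suc n)) * ennreal (max 0 (b - a))"
        by (simp only: nn_integral_const emeas)
      finally show "(\<integral>\<^sup>+x. ennreal (norm (f x - s n x)) \<partial>?M)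
          \<le> ennreal (max 0 (b - a) * (1 / real (Suc n)))"
        by (subst ennreal_mult) (auto simp: mult.commute)
    qed
    show "(\<lambda>n. ennreal (max 0 (b - a) * (1 / real (Suc n)))) \<longlonglongrightarrow> 0"
      using tendsto_ennrealI[OF null] by simp
  qed
  have fint: "f integrable_on {a..b}"
    using cont by (rule integrable_continuous_interval)
  have bound: "norm (Bochner_Integration.simple_bochner_integral ?M (s n) - integral {a..b} f)
      \<le> max 0 (b - a) * (1 / real (Suc n))" for n
  proof -
    \<comment> \<open>Testing the difference of the two integrals with itself leaves only real integrals.\<close>
    define w where "w = Bochner_Integration.simple_bochner_integral ?M (s n) - integral {a..b} f"
    have bl: "bounded_linear (\<lambda>y. y \<bullet> w)"
      by (rule bounded_linear_inner_left)
    have sw: "Bochner_Integration.simple_bochner_integrable ?M (\<lambda>x. s n x \<bullet> w)"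
      using simple_bochner_integrable_compose2[OF _ sb sb, of "\<lambda>y _. y \<bullet> w"] by simp
    have "integrable ?M (\<lambda>x. s n x \<bullet> w)"
      using sw by (rule integrableI_simple_bochner_integrable)
    then have s_int: "((\<lambda>x. s n x \<bullet> w) has_integral (integral\<^sup>L ?M (\<lambda>x. s n x \<bullet> w))) {a..b}"
      by (rule has_integral_integral_lebesgue_on) simp
    have s_eq: "integral\<^sup>L ?M (\<lambda>x. s n x \<bullet> w)
        = Bochner_Integration.simple_bochner_integral ?M (s n) \<bullet> w"
      using simple_bochner_integrable_eq_integral[OF sw]
        simple_bochner_integral_linear[OF bounded_linear.linear[OF bl] sb] by simp
    have f_int: "((\<lambda>x. f x \<bullet> w) has_integral (integral {a..b} f \<bullet> w)) {a..b}"
      using has_integral_linear[OF integrable_integral[OF fint] bl] by (simp add: o_def)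
    have "integral\<^sup>L ?M (\<lambda>x. s n x \<bullet> w) - integral {a..b} f \<bullet> w = w \<bullet> w"
      unfolding s_eq inner_diff_left[symmetric] w_def[symmetric] ..
    with has_integral_diff[OF s_int f_int]
    have diff_int: "((\<lambda>x. s n x \<bullet> w - f x \<bullet> w) has_integral w \<bullet> w) {a..b}"
      by simp
    have le: "s n x \<bullet> w - f x \<bullet> w \<le> 1 / real (Suc n) * norm w" if "x \<in> {a..b}" for x
    proof -
      have "s n x \<bullet> w - f x \<bullet> w \<le> norm (s n x - f x) * norm w"
        using norm_cauchy_schwarz[of "s n x - f x" w] by (simp add: inner_diff_left)
      also have "\<dots> \<le> 1 / real (Suc n) * norm w"
        using close[OF that, of n] by (intro mult_right_mono) (auto simp: norm_minus_commute)
      finally show ?thesis .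
    qed
    have const_int: "((\<lambda>x. 1 / real (Suc n) * norm w) has_integral
        (max 0 (b - a) * (1 / real (Suc n) * norm w))) {a..b}"
      using has_integral_const_real[of "1 / real (Suc n) * norm w" a b] by (simp add: max_def)
    have "w \<bullet> w \<le> max 0 (b - a) * (1 / real (Suc n) * norm w)"
      using diff_int const_int le by (rule has_integral_le)
    then have "norm w * norm w \<le> (max 0 (b - a) * (1 / real (Suc n))) * norm w"
      by (simp add: dot_square_norm power2_eq_square)
    then have "norm w \<le> max 0 (b - a) * (1 / real (Suc n))" if "w \<noteq> 0"
      by (rule mult_right_le_imp_le) (use that in simp)
    then show ?thesis
      unfolding w_def[symmetric] by (cases "w = 0") auto
  qed
  have "(\<lambda>n. Bochner_Integration.simple_bochner_integral ?M (s n)) \<longlonglongrightarrow> integral {a..b} f"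
    by (rule Lim_null[THEN iffD2], rule Lim_null_comparison[OF _ null])
       (use bound in \<open>auto intro: always_eventually\<close>)
  with meas sb lim show ?thesis
    unfolding has_banach_bochner_integral_def by blast
qed

subsection \<open>Orthogonal projections in Hilbert spaces\<close>

lemma subspace_closure:
  fixes V :: "'a::real_normed_vector set"
  assumes V: "subspace V"
  shows "subspace (closure V)"
proof (rule subspaceI)
  show "0 \<in> closure V"
    using subspace_0[OF V] closure_subset by auto
next
  fix x y assume "x \<in> closure V" "y \<in> closure V"
  then obtain p q where "\<And>n. p n \<in> V" "p \<longlonglongrightarrow> x" "\<And>n. q n \<in> V" "q \<longlonglongrightarrow> y"
    unfolding closure_sequential by metis
  then show "x + y \<in> closure V"
    unfolding closure_sequential
    by (intro exI[of _ "\<lambda>n. p n + q n"]) (auto intro: tendsto_add subspace_add[OF V])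
next
  fix c x assume "x \<in> closure V"
  then obtain p where "\<And>n. p n \<in> V" "p \<longlonglongrightarrow> x"
    unfolding closure_sequential by metis
  then show "c *\<^sub>R x \<in> closure V"
    unfolding closure_sequential
    by (intro exI[of _ "\<lambda>n. c *\<^sub>R p n"]) (auto intro: tendsto_scaleR subspace_scale[OF V])
qed

text \<open>The parallelogram law for \<open>z - x\<close> and \<open>z - y\<close>: two points
  almost equally near to \<open>z\<close> are close together unless their midpoint is much
  nearer.\<close>

lemma parallelogram_midpoint:
  fixes x y z :: "'a::real_inner"
  shows "(dist x y)\<^sup>2 = 2 * (dist z x)\<^sup>2 + 2 * (dist z y)\<^sup>2 - 4 * (dist z ((1/2) *\<^sub>R (x + y)))\<^sup>2"
  by (simp add: dist_norm power2_norm_eq_inner inner_diff_left inner_diff_right inner_add_left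
      inner_add_right inner_commute algebra_simps)

text \<open>Midpoints of a minimising sequence stay in \<open>V\<close>, hence at distance at least
  \<open>d\<close> from \<open>g\<close>. The parallelogram law then makes the sequence Cauchy, and
  its limit lies in \<open>V\<close> by closedness.\<close>

lemma closed_subspace_nearest_point_exists:
  fixes V :: "'a::{real_inner, banach} set"
  assumes V: "subspace V" and cl: "closed V"
  obtains p where "p \<in> V" "dist g p = infdist g V"
proof -
  define d where "d = infdist g V"
  have ne: "V \<noteq> {}"
    using subspace_0[OF V] by auto
  have d0: "d \<ge> 0"
    unfolding d_def by (rule infdist_nonneg)
  have "\<exists>x\<in>V. dist g x < d + 1 / real (Suc n)" for n
  proof (rule ccontr)
    assume "\<not> ?thesis"
    then have "d + 1 / real (Suc n) \<le> d"
      unfolding d_def infdist_notempty[OF ne] by (intro cINF_greatest[OF ne]) auto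
    then show False by simp
  qed
  then obtain x where x: "\<And>n. x n \<in> V" "\<And>n. dist g (x n) < d + 1 / real (Suc n)"
    by metis
  have lim: "(\<lambda>n. dist g (x n)) \<longlonglongrightarrow> d"
  proof (rule tendsto_sandwich[OF _ _ tendsto_const])
    show "\<forall>\<^sub>F n in sequentially. d \<le> dist g (x n)"
      using x(1) by (auto simp: d_def intro!: always_eventually infdist_le)
    show "\<forall>\<^sub>F n in sequentially. dist g (x n) \<le> d + 1 / real (Suc n)"
      using x(2) by (auto intro!: always_eventually less_imp_le)
    show "(\<lambda>n. d + 1 / real (Suc n)) \<longlonglongrightarrow> d"
      using tendsto_add[OF tendsto_const LIMSEQ_inverse_real_of_nat, of d]
      by (simp add: inverse_eq_divide)
  qed
  have "Cauchy x"
  proof (rule metric_CauchyI)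
    fix e :: real assume e: "e > 0"
    have "(\<lambda>n. (dist g (x n))\<^sup>2) \<longlonglongrightarrow> d\<^sup>2"
      using lim by (intro tendsto_intros)
    \<comment> \<open>Each squared distance enters the parallelogram law with weight 2, so two
      excesses of \<open>e\<^sup>2 / 4\<close> add up to \<open>e\<^sup>2\<close> and the terms in
      \<open>d\<^sup>2\<close> cancel.\<close>
    then have "\<forall>\<^sub>F n in sequentially. (dist g (x n))\<^sup>2 < d\<^sup>2 + e\<^sup>2 / 4"
      using e by (intro order_tendstoD) auto
    then obtain N where N: "\<And>n. n \<ge> N \<Longrightarrow> (dist g (x n))\<^sup>2 < d\<^sup>2 + e\<^sup>2 / 4"
      unfolding eventually_sequentially by blast
    have "dist (x i) (x j) < e" if "i \<ge> N" "j \<ge> N" for i j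
    proof -
      have "(1/2) *\<^sub>R (x i + x j) \<in> V"
        by (intro subspace_scale subspace_add V x)
      then have "d \<le> dist g ((1/2) *\<^sub>R (x i + x j))"
        unfolding d_def by (rule infdist_le)
      then have "d\<^sup>2 \<le> (dist g ((1/2) *\<^sub>R (x i + x j)))\<^sup>2"
        using d0 by (rule power_mono)
      then have "(dist (x i) (x j))\<^sup>2 < e\<^sup>2"
        using parallelogram_midpoint[of "x i" "x j" g] N[OF that(1)] N[OF that(2)] by linarith
      then show ?thesis
        by (rule power2_less_imp_less) (use e in simp)
    qed
    then show "\<exists>N. \<forall>i\<ge>N. \<forall>j\<ge>N. dist (x i) (x j) < e"
      by blast
  qed
  then obtain p where p: "x \<longlonglongrightarrow> p"
    using Cauchy_convergent convergent_def by blast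
  have "p \<in> V"
    using cl x(1) p by (rule closed_sequentially)
  moreover have "dist g p = d"
    using tendsto_dist[OF tendsto_const p] lim by (rule LIMSEQ_unique)
  ultimately show thesis
    using that unfolding d_def by blast
qed

lemma nearest_point_orthogonal:
  fixes V :: "'a::real_inner set"
  assumes V: "subspace V" and p: "p \<in> V" "dist g p = infdist g V" and h: "h \<in> V"
  shows "(g - p) \<bullet> h = 0"
proof (cases "h = 0")
  case False
  \<comment> \<open>The minimiser of the quadratic \<open>norm (g - p - c h)\<close> squared in
    \<open>c\<close>. Moving \<open>p\<close> by it would lower the squared distance by
    \<open>((g - p) \<bullet> h)\<^sup>2 / (h \<bullet> h)\<close>, so minimality forces this to
    vanish.\<close>
  define c where "c = ((g - p) \<bullet> h) / (h \<bullet> h)"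
  have "p + c *\<^sub>R h \<in> V"
    by (intro subspace_add subspace_scale V p h)
  then have "dist g p \<le> dist g (p + c *\<^sub>R h)"
    unfolding p(2) by (rule infdist_le)
  then have "(norm (g - p))\<^sup>2 \<le> (norm (g - p - c *\<^sub>R h))\<^sup>2"
    by (intro power_mono) (auto simp: dist_norm diff_diff_eq)
  also have "\<dots> = (norm (g - p))\<^sup>2 - 2 * c * ((g - p) \<bullet> h) + c * (c * (h \<bullet> h))"
    unfolding power2_norm_eq_inner
    by (simp only: inner_diff_left inner_diff_right inner_commute inner_scaleR_left inner_scaleR_right)
  also have "c * (h \<bullet> h) = (g - p) \<bullet> h"
    using False by (simp add: c_def)
  finally have "c * ((g - p) \<bullet> h) \<le> 0"
    by simp
  then have "((g - p) \<bullet> h)\<^sup>2 / (h \<bullet> h) \<le> 0"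
    by (simp add: c_def power2_eq_square)
  moreover have "h \<bullet> h > 0"
    using False by simp
  ultimately show ?thesis
    by (simp add: divide_le_0_iff)
qed simp

text \<open>The nearest point gives existence. For uniqueness, the difference of two candidates lies
  in \<open>V\<close> and is orthogonal to both residuals, hence to itself.\<close>

lemma orth_proj:
  fixes V :: "'a::{real_inner, banach} set"
  assumes V: "subspace V" and cl: "closed V"
  shows orth_proj_in: "orth_proj V g \<in> V"
    and orth_proj_orthogonal: "h \<in> V \<Longrightarrow> (g - orth_proj V g) \<bullet> h = 0"
proof -
  obtain p where p: "p \<in> V" "dist g p = infdist g V"
    using closed_subspace_nearest_point_exists[OF assms] .
  have "\<exists>!p. p \<in> V \<and> (\<forall>h\<in>V. (g - p) \<bullet> h = 0)"
  proof (rule ex1I)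
    show "p \<in> V \<and> (\<forall>h\<in>V. (g - p) \<bullet> h = 0)"
      using p nearest_point_orthogonal[OF V p] by blast
    fix q assume q: "q \<in> V \<and> (\<forall>h\<in>V. (g - q) \<bullet> h = 0)"
    then have "q - p \<in> V"
      using p V by (auto intro: subspace_diff)
    then have "(g - p) \<bullet> (q - p) = 0" "(g - q) \<bullet> (q - p) = 0"
      using q nearest_point_orthogonal[OF V p] by blast+
    then have "(q - p) \<bullet> (q - p) = 0"
      by (simp add: inner_diff_left)
    then show "q = p"
      by simp
  qed
  from theI'[OF this] have "orth_proj V g \<in> V \<and> (\<forall>h\<in>V. (g - orth_proj V g) \<bullet> h = 0)"
    unfolding orth_proj_def .
  then show "orth_proj V g \<in> V" "h \<in> V \<Longrightarrow> (g - orth_proj V g) \<bullet> h = 0"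
    by blast+
qed

subsection \<open>Kernel sections\<close>

lemma native_space_reproducing:
  assumes "native_space K ev"
  shows "ksec K ev x \<bullet> g = ev g x"
  using assms by (simp add: native_space_def)

lemma ev_ksec:
  assumes "native_space K ev"
  shows "ev (ksec K ev x) = K x"
proof -
  from assms have inj: "inj ev" and "K x \<in> range ev"
    by (auto simp: native_space_def)
  then obtain k where "ev k = K x"
    by auto
  then have "\<exists>!k. ev k = K x"
    using inj by (metis injD)
  then show ?thesis
    unfolding ksec_def by (rule theI')
qed

text \<open>The order \<open>K y x\<close> arises because the reproducing property evaluates the
  section at \<open>y\<close> in the point \<open>x\<close>.\<close>

lemma inner_ksec:
  assumes "native_space K ev"
  shows "ksec K ev x \<bullet> ksec K ev y = K y x"
  by (simp add: native_space_reproducing[OF assms] ev_ksec[OF assms])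

lemma norm_ksec:
  assumes "native_space K ev"
  shows "norm (ksec K ev x) = sqrt (K x x)"
  by (simp add: norm_eq_sqrt_inner inner_ksec[OF assms])

text \<open>By the reproducing property, the squared distance between two sections is a combination
  of four kernel values. It is continuous along \<open>f\<close> and vanishes at
  \<open>a\<close>.\<close>

lemma continuous_on_ksec:
  fixes K :: "'x::topological_space \<Rightarrow> 'x \<Rightarrow> real"
  assumes ns: "native_space K ev" and cK: "continuous_on UNIV (\<lambda>(x, y). K x y)"
    and cf: "continuous_on A f"
  shows "continuous_on A (\<lambda>t. ksec K ev (f t))"
proof -
  have K: "continuous_on A (\<lambda>t. K (p t) (q t))" if "continuous_on A p" "continuous_on A q" for p q
    using continuous_on_compose2[OF cK continuous_on_Pair[OF that]] by simp
  show ?thesis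
    unfolding continuous_on_def
  proof (intro ballI)
    fix a assume a: "a \<in> A"
    have eq: "norm (ksec K ev (f t) - ksec K ev (f a))
        = sqrt (K (f t) (f t) - K (f a) (f t) - K (f t) (f a) + K (f a) (f a))" for t
      by (simp add: norm_eq_sqrt_inner inner_diff_left inner_diff_right inner_ksec[OF ns])
    have "continuous_on A
        (\<lambda>t. sqrt (K (f t) (f t) - K (f a) (f t) - K (f t) (f a) + K (f a) (f a)))"
      by (intro continuous_intros K cf)
    then have "continuous_on A (\<lambda>t. norm (ksec K ev (f t) - ksec K ev (f a)))"
      by (simp only: eq)
    with a have "((\<lambda>t. norm (ksec K ev (f t) - ksec K ev (f a)))
        \<longlongrightarrow> norm (ksec K ev (f a) - ksec K ev (f a))) (at a within A)"
      unfolding continuous_on_def by blast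
    then have "((\<lambda>t. ksec K ev (f t) - ksec K ev (f a)) \<longlongrightarrow> 0) (at a within A)"
      by (simp add: tendsto_norm_zero_iff)
    then show "((\<lambda>t. ksec K ev (f t)) \<longlongrightarrow> ksec K ev (f a)) (at a within A)"
      by (rule Lim_null[THEN iffD2])
  qed
qed

subsection \<open>The excitation form\<close>

text \<open>The bilinear form of the excitation operator, written as a real integral so that
  additivity and estimates come from scalar calculus.\<close>

definition excitation_form ::
    "('x \<Rightarrow> 'x \<Rightarrow> real) \<Rightarrow> ('h::{real_inner, banach} \<Rightarrow> 'x \<Rightarrow> real) \<Rightarrow> (real \<Rightarrow> 'x)
       \<Rightarrow> real \<Rightarrow> real \<Rightarrow> 'h \<Rightarrow> 'h \<Rightarrow> real" where
  "excitation_form K ev \<phi> a b g h =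
     integral {a..b} (\<lambda>\<tau>. (ksec K ev (\<phi> \<tau>) \<bullet> g) * (ksec K ev (\<phi> \<tau>) \<bullet> h))"

locale kernel_trajectory =
  fixes K :: "'x::topological_space \<Rightarrow> 'x \<Rightarrow> real"
    and ev :: "'h::{real_inner, banach} \<Rightarrow> 'x \<Rightarrow> real"
    and \<phi> :: "real \<Rightarrow> 'x"
  assumes native: "native_space K ev"
    and cont_kernel: "continuous_on UNIV (\<lambda>(x, y). K x y)"
    and cont_traj: "continuous_on {0..} \<phi>"
begin

abbreviation T where "T \<equiv> excitation_op K ev \<phi>"
abbreviation B where "B \<equiv> excitation_form K ev \<phi>"

text \<open>The trajectory is known to be continuous only on \<open>{0..}\<close>; hence the
  recurring assumption that \<open>a\<close> is nonnegative.\<close>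

lemma continuous_on_ksec_traj:
  assumes "a \<ge> 0"
  shows "continuous_on {a..b} (\<lambda>\<tau>. ksec K ev (\<phi> \<tau>))"
proof -
  have "{a..b} \<subseteq> {0..}"
    using assms by auto
  then show ?thesis
    using continuous_on_subset[OF continuous_on_ksec[OF native cont_kernel cont_traj]] by blast
qed

lemma integrable_form:
  assumes "a \<ge> 0"
  shows "(\<lambda>\<tau>. (ksec K ev (\<phi> \<tau>) \<bullet> g) * (ksec K ev (\<phi> \<tau>) \<bullet> h)) integrable_on {a..b}"
  using continuous_on_ksec_traj[OF assms]
  by (intro integrable_continuous_interval continuous_intros)

text \<open>The bridge from operator to form: the integrand is continuous, so its Bochner integral
  is the Henstock-Kurzweil one, which commutes with pairing against \<open>h\<close>.\<close>

lemma inner_excitation_op: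
  assumes "a \<ge> 0"
  shows "T a b g \<bullet> h = B a b g h"
proof -
  let ?f = "\<lambda>\<tau>. (ksec K ev (\<phi> \<tau>) \<bullet> g) *\<^sub>R ksec K ev (\<phi> \<tau>)"
  have cont: "continuous_on {a..b} ?f"
    using continuous_on_ksec_traj[OF assms] by (intro continuous_intros)
  have "T a b g = integral {a..b} ?f"
    unfolding excitation_op_def
    by (rule banach_bochner_integral_eqI[OF has_banach_bochner_integral_continuous[OF cont]])
  then show ?thesis
    using integral_linear[OF integrable_continuous_interval[OF cont] bounded_linear_inner_left, of h]
    by (simp add: excitation_form_def o_def)
qed

lemma form_diff_left:
  assumes "a \<ge> 0"
  shows "B a b (g - g') h = B a b g h - B a b g' h"
  unfolding excitation_form_def
  by (subst integral_diff[symmetric])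
     (auto intro: integrable_form[OF assms] simp: inner_diff_right left_diff_distrib)

lemma form_combine:
  assumes "0 \<le> a" "a \<le> b" "b \<le> c"
  shows "B a c g h = B a b g h + B b c g h"
  unfolding excitation_form_def
  using assms by (intro Henstock_Kurzweil_Integration.integral_combine[symmetric] integrable_form) auto

text \<open>Since \<open>norm (ksec K ev x) = sqrt (K x x)\<close>, Cauchy-Schwarz bounds each
  factor of the integrand by \<open>Kbar\<close> times a norm. Integrating this constant bound
  yields the interval length.\<close>

lemma form_le:
  assumes ab: "0 \<le> a" "a \<le> b" and bound: "\<And>x. sqrt (K x x) \<le> Kbar"
  shows "B a b g h \<le> Kbar\<^sup>2 * (b - a) * (norm g * norm h)"
proof -
  have "(ksec K ev x \<bullet> g) * (ksec K ev x \<bullet> h) \<le> Kbar\<^sup>2 * (norm g * norm h)" for x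
  proof -
    have k: "\<bar>ksec K ev x \<bullet> u\<bar> \<le> Kbar * norm u" for u
      using Cauchy_Schwarz_ineq2[of "ksec K ev x" u]
        mult_right_mono[OF bound[of x, folded norm_ksec[OF native]], of "norm u"] by simp
    have "(ksec K ev x \<bullet> g) * (ksec K ev x \<bullet> h) \<le> \<bar>ksec K ev x \<bullet> g\<bar> * \<bar>ksec K ev x \<bullet> h\<bar>"
      by (simp flip: abs_mult)
    also have "\<dots> \<le> (Kbar * norm g) * (Kbar * norm h)"
      using k[of g] by (intro mult_mono k) auto
    finally show ?thesis
      by (simp add: power2_eq_square mult_ac)
  qed
  then have "B a b g h \<le> integral {a..b} (\<lambda>_. Kbar\<^sup>2 * (norm g * norm h))"
    unfolding excitation_form_def by (intro integral_le integrable_form ab) auto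
  then show ?thesis
    using ab by (simp add: mult_ac)
qed

text \<open>Each window of length \<open>\<Delta>\<close> contributes at least
  \<open>\<gamma>1 * (norm g)\<^sup>2\<close>, and consecutive windows add up by
  \<open>form_combine\<close>.\<close>

lemma form_coercive:
  assumes "persistently_exciting K ev \<phi> V \<gamma>1 \<gamma>2 \<Delta>" and g: "g \<in> V"
  shows "\<gamma>1 * real m * (norm g)\<^sup>2 \<le> B 0 (real m * \<Delta>) g g"
proof (induction m)
  case 0
  show ?case by (simp add: excitation_form_def)
next
  case (Suc m)
  have \<Delta>: "\<Delta> > 0"
    using assms by (simp add: persistently_exciting_def)
  then have t: "0 \<le> real m * \<Delta>"
    by simp
  have "\<gamma>1 * (norm g)\<^sup>2 \<le> B (real m * \<Delta>) (real m * \<Delta> + \<Delta>) g g"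
    using assms t by (simp add: persistently_exciting_def flip: inner_excitation_op)
  moreover have "B 0 (real m * \<Delta> + \<Delta>) g g
      = B 0 (real m * \<Delta>) g g + B (real m * \<Delta>) (real m * \<Delta> + \<Delta>) g g"
    using t \<Delta> by (intro form_combine) auto
  ultimately show ?case
    using Suc.IH by (simp add: algebra_simps)
qed

end

section \<open>The error estimate for the optimal regressor\<close>

theorem mainTheorem2:
  fixes K :: "'x::complete_space \<Rightarrow> 'x \<Rightarrow> real"
    and ev :: "'h::{real_inner, banach} \<Rightarrow> 'x \<Rightarrow> real"
    and Kbar \<gamma> \<gamma>1 \<gamma>2 \<Delta> t :: real
    and \<phi> :: "real \<Rightarrow> 'x"
    and G ghat :: 'h
    and S :: "'x set"
    and m :: nat
  assumes "admissible_kernel K"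
    and "continuous_on UNIV (\<lambda>(x, y). K x y)"
    and "native_space K ev"
    and "Kbar > 0" and "\<forall>x. sqrt (K x x) \<le> Kbar"
    and "continuous_on {0..} \<phi>"
    and "\<gamma> > 0"
    and "persistently_exciting K ev \<phi> (native_subspace K ev S) \<gamma>1 \<gamma>2 \<Delta>"
    and "m > 0" and "t = real m * \<Delta>"
    and "optimal_regressor K ev \<phi> (native_subspace K ev S) \<gamma> G t ghat"
  shows "norm (ghat - orth_proj (native_subspace K ev S) G)
    \<le> Kbar\<^sup>2 * real m * \<Delta> / (\<gamma>1 * real m + \<gamma>)
        * norm (G - orth_proj (native_subspace K ev S) G)
      + \<gamma> / (\<gamma>1 * real m + \<gamma>) * norm (orth_proj (native_subspace K ev S) G)"
proof -
  interpret kernel_trajectory K ev \<phi>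
    by unfold_locales (use assms in auto)
  define V where "V = native_subspace K ev S"
  define P where "P = orth_proj V G"
  define e where "e = ghat - P"
  define D where "D = \<gamma>1 * real m + \<gamma>"
  have V: "subspace V" "closed V"
    by (auto simp: V_def native_subspace_def intro: subspace_closure)
  have P: "P \<in> V"
    unfolding P_def by (rule orth_proj_in[OF V])
  have pe: "persistently_exciting K ev \<phi> V \<gamma>1 \<gamma>2 \<Delta>"
    using assms(8) by (simp add: V_def)
  then have "\<gamma>1 > 0" "\<Delta> > 0"
    by (auto simp: persistently_exciting_def)
  then have D: "D > 0" and t: "t \<ge> 0"
    using assms(7,10) by (auto simp: D_def add_nonneg_pos)
  have opt: "ghat \<in> V" "\<And>h. h \<in> V \<Longrightarrow> (T 0 t ghat + \<gamma> *\<^sub>R ghat) \<bullet> h = T 0 t G \<bullet> h"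
    using assms(11) by (auto simp: optimal_regressor_def V_def)
  have e: "e \<in> V"
    unfolding e_def by (rule subspace_diff[OF V(1) opt(1) P])
  have "B 0 t ghat e + \<gamma> * (ghat \<bullet> e) = B 0 t G e"
    using opt(2)[OF e] by (simp add: inner_add_left inner_excitation_op)
  then have "B 0 t e e + \<gamma> * (e \<bullet> e) = B 0 t (G - P) e - \<gamma> * (P \<bullet> e)"
    \<comment> \<open>Only the left arguments of the form and of the inner product are expanded to
      \<open>ghat - P\<close>; the right ones stay \<open>e\<close>, the test vector.\<close>
    by (subst (1) e_def, subst (2) e_def)
       (simp add: form_diff_left inner_diff_left algebra_simps)
  moreover have "B 0 t (G - P) e \<le> Kbar\<^sup>2 * t * (norm (G - P) * norm e)"
    using form_le[of 0 t Kbar "G - P" e] t assms(5) by simp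
  moreover have "- \<gamma> * (P \<bullet> e) \<le> \<gamma> * (norm P * norm e)"
    using mult_left_mono[OF norm_cauchy_schwarz[of "- P" e], of \<gamma>] assms(7) by simp
  moreover have "\<gamma>1 * real m * (norm e)\<^sup>2 \<le> B 0 t e e"
    using form_coercive[OF pe e] assms(10) by simp
  ultimately have "(D * norm e) * norm e \<le> (Kbar\<^sup>2 * t * norm (G - P) + \<gamma> * norm P) * norm e"
    by (simp add: D_def dot_square_norm power2_eq_square algebra_simps)
  \<comment> \<open>This settles \<open>e = 0\<close>, where \<open>norm e\<close> cannot be
    cancelled.\<close>
  moreover have "0 \<le> Kbar\<^sup>2 * t * norm (G - P) + \<gamma> * norm P"
    using t assms(7) by simp
  ultimately have "D * norm e \<le> Kbar\<^sup>2 * t * norm (G - P) + \<gamma> * norm P"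
    by (cases "e = 0") (auto intro: mult_right_le_imp_le)
  then have "norm e \<le> (Kbar\<^sup>2 * t * norm (G - P) + \<gamma> * norm P) / D"
    using D by (simp add: field_simps)
  then show ?thesis
    unfolding assms(10) by (simp add: e_def P_def V_def D_def add_divide_distrib mult.assoc)
qed

end
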